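(* The complete set of all $(\alpha, \beta) \in \mathbb{R}^2$ such that \[ \lfloor \alpha \lfloor \beta x\rfloor \rfloor = \lfloor \beta \lfloor \alpha x\rfloor \rfloor \] holds for all $x \in \mathbb{R}$ consists of: (i) the three continuous families $(\alpha, \alpha)$, $(\alpha, 0)$, $(0, \alpha)$ for all $\alpha \in \mathbb{R}$; (ii) the infinite discrete family \[ \left\{ (\alpha, \beta) = \left(\frac{1}{m}, \frac{1}{n}\right) : m, n \ge 1 \right\}, \] where $m, n$ are positive integers. (The families overlap when $m = n$.) That is, a pair $(\alpha,\beta)\in\mathbb{R}^2$ satisfies the displayed identity for all real $x$ if and only if it belongs to one of the families in (i) or to the family in (ii).
   Context: $\lfloor x \rfloor$ denotes the floor function, i.e. the greatest integer less than or equal to the real number $x$. *)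

theory Defs
  imports Complex_Main
begin

end

theory Submission
  imports Defs
begin

text \<open>
  For positive \<open>\<alpha>\<close> and \<open>\<beta>\<close>, \<open>n \<le> \<lfloor>\<alpha> \<lfloor>\<beta> x\<rfloor>\<rfloor>\<close> holds exactly when
  \<open>\<lceil>n / \<alpha>\<rceil> \<le> \<beta> x\<close>, so comparing the jump points of the two sides shows that the identity forces
  \<open>\<alpha> \<lceil>n / \<alpha>\<rceil> = \<beta> \<lceil>n / \<beta>\<rceil>\<close> for every integer \<open>n\<close>. Subtracting the equations
  for \<open>n = 1\<close> and \<open>n = -1\<close> gives \<open>\<alpha> (\<lceil>1 / \<alpha>\<rceil> - \<lfloor>1 / \<alpha>\<rfloor>) = \<beta> (\<lceil>1 / \<beta>\<rceil> - \<lfloor>1 / \<beta>\<rfloor>)\<close>,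
  where each difference is \<open>0\<close> or \<open>1\<close> according to whether the reciprocal is an integer.
  Pairs with a negative entry are excluded by evaluating at one suitable \<open>x\<close>.
\<close>

definition dilated_floors_commute :: "real \<Rightarrow> real \<Rightarrow> bool" where
  "dilated_floors_commute \<alpha> \<beta> \<longleftrightarrow>
     (\<forall>x::real. \<lfloor>\<alpha> * real_of_int \<lfloor>\<beta> * x\<rfloor>\<rfloor> = \<lfloor>\<beta> * real_of_int \<lfloor>\<alpha> * x\<rfloor>\<rfloor>)"

lemma dilated_floors_commuteD:
  "dilated_floors_commute \<alpha> \<beta> \<Longrightarrow>
     \<lfloor>\<alpha> * real_of_int \<lfloor>\<beta> * x\<rfloor>\<rfloor> = \<lfloor>\<beta> * real_of_int \<lfloor>\<alpha> * x\<rfloor>\<rfloor>"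
  by (simp add: dilated_floors_commute_def)

lemma dilated_floors_commute_sym:
  "dilated_floors_commute \<alpha> \<beta> \<Longrightarrow> dilated_floors_commute \<beta> \<alpha>"
  by (simp add: dilated_floors_commute_def)

text \<open>Division by \<alpha> turns the bound into one on the integer
  \<open>\<lfloor>y\<rfloor>\<close>, so it may be rounded up; this locates the jump to level
  \<open>n\<close>.\<close>

lemma le_floor_mult_floor_iff:
  fixes \<alpha> y :: real
  assumes "\<alpha> > 0"
  shows "n \<le> \<lfloor>\<alpha> * real_of_int \<lfloor>y\<rfloor>\<rfloor> \<longleftrightarrow> real_of_int \<lceil>real_of_int n / \<alpha>\<rceil> \<le> y"
proof -
  have "n \<le> \<lfloor>\<alpha> * real_of_int \<lfloor>y\<rfloor>\<rfloor> \<longleftrightarrow> real_of_int n / \<alpha> \<le> real_of_int \<lfloor>y\<rfloor>"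
    using assms by (simp add: le_floor_iff field_simps)
  also have "\<dots> \<longleftrightarrow> \<lceil>real_of_int n / \<alpha>\<rceil> \<le> \<lfloor>y\<rfloor>"
    by (simp add: ceiling_le_iff)
  finally show ?thesis by (simp add: le_floor_iff)
qed

lemma dilated_floors_commute_jump_le:
  assumes "\<alpha> > 0" "\<beta> > 0" and comm: "dilated_floors_commute \<alpha> \<beta>"
  shows "\<beta> * real_of_int \<lceil>real_of_int n / \<beta>\<rceil> \<le> \<alpha> * real_of_int \<lceil>real_of_int n / \<alpha>\<rceil>"
proof -
  \<comment> \<open>The least point at which the side with inner factor \<beta> reaches level
    \<open>n\<close>; the other side must have reached \<open>n\<close> there too.\<close>
  define x where "x = real_of_int \<lceil>real_of_int n / \<alpha>\<rceil> / \<beta>"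
  have "real_of_int \<lceil>real_of_int n / \<alpha>\<rceil> \<le> \<beta> * x"
    using assms by (simp add: x_def)
  then have "real_of_int \<lceil>real_of_int n / \<beta>\<rceil> \<le> \<alpha> * x"
    using dilated_floors_commuteD[OF comm, of x] assms le_floor_mult_floor_iff by metis
  then show ?thesis
    using assms by (simp add: x_def field_simps)
qed

lemma dilated_floors_commute_jump_eq:
  assumes "\<alpha> > 0" "\<beta> > 0" "dilated_floors_commute \<alpha> \<beta>"
  shows "\<alpha> * real_of_int \<lceil>real_of_int n / \<alpha>\<rceil> = \<beta> * real_of_int \<lceil>real_of_int n / \<beta>\<rceil>"
  using assms dilated_floors_commute_jump_le dilated_floors_commute_sym by (metis antisym)

lemma inverse_Ints_posE:
  fixes \<alpha> :: real
  assumes "\<alpha> > 0" "1 / \<alpha> \<in> \<int>"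
  obtains m :: nat where "m \<ge> 1" "\<alpha> = 1 / real m"
proof -
  from assms have "1 / \<alpha> \<in> \<nat>" by (simp add: Nats_altdef2)
  then obtain m where m: "1 / \<alpha> = real m" by (auto elim: Nats_cases)
  with assms have "m \<noteq> 0" by (cases "m = 0") auto
  moreover from m have "\<alpha> = 1 / real m" by (metis div_by_1 divide_divide_eq_right mult_1)
  ultimately show ?thesis using that by simp
qed

lemma dilated_floors_commute_pos:
  assumes pos: "\<alpha> > 0" "\<beta> > 0" and comm: "dilated_floors_commute \<alpha> \<beta>"
  shows "\<alpha> = \<beta> \<or> 1 / \<alpha> \<in> \<int> \<and> 1 / \<beta> \<in> \<int>"
proof -
  have ceil: "\<alpha> * real_of_int \<lceil>1 / \<alpha>\<rceil> = \<beta> * real_of_int \<lceil>1 / \<beta>\<rceil>"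
    using dilated_floors_commute_jump_eq[OF assms, of 1] by simp
  have "\<alpha> * real_of_int \<lfloor>1 / \<alpha>\<rfloor> = \<beta> * real_of_int \<lfloor>1 / \<beta>\<rfloor>"
    using dilated_floors_commute_jump_eq[OF assms, of "-1"] by (simp add: ceiling_minus)
  with ceil have "\<alpha> * real_of_int (\<lceil>1 / \<alpha>\<rceil> - \<lfloor>1 / \<alpha>\<rfloor>) = \<beta> * real_of_int (\<lceil>1 / \<beta>\<rceil> - \<lfloor>1 / \<beta>\<rfloor>)"
    by (simp add: right_diff_distrib)
  \<comment> \<open>Both differences being 1 gives \<open>\<alpha> = \<beta>\<close>, both being 0
    makes both reciprocals integers, and positivity rules out one of each.\<close>
  then show ?thesis
    using pos by (simp add: ceiling_altdef split: if_splits)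
      (metis Ints_of_int)+
qed

lemma not_dilated_floors_commute_neg_pos:
  assumes "\<alpha> < 0" "\<beta> > 0"
  shows "\<not> dilated_floors_commute \<alpha> \<beta>"
proof
  assume "dilated_floors_commute \<alpha> \<beta>"
  \<comment> \<open>This \<open>x\<close> makes \<open>\<beta> * x - \<alpha> * x = 1\<close> with
    the two products of opposite sign, so they lie in (0, 1) and (-1, 0).\<close>
  note comm = dilated_floors_commuteD[OF this, of "1 / (\<beta> - \<alpha>)"]
  have "\<lfloor>\<beta> * (1 / (\<beta> - \<alpha>))\<rfloor> = 0" "\<lfloor>\<alpha> * (1 / (\<beta> - \<alpha>))\<rfloor> = -1"
    using assms by (simp_all add: floor_eq_iff field_simps)
  with comm have "\<lfloor>- \<beta>\<rfloor> = 0" by simp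
  with assms show False by linarith
qed

lemma not_dilated_floors_commute_neg_neg:
  assumes "\<beta> < \<alpha>" "\<alpha> < 0"
  shows "\<not> dilated_floors_commute \<alpha> \<beta>"
proof
  assume "dilated_floors_commute \<alpha> \<beta>"
  \<comment> \<open>Here \<open>\<beta> * x = 1\<close> while \<open>\<alpha> * x\<close> lies in
    (0, 1), so the identity collapses to \<open>\<lfloor>\<alpha>\<rfloor> = 0\<close>.\<close>
  note comm = dilated_floors_commuteD[OF this, of "1 / \<beta>"]
  have "\<lfloor>\<alpha> * (1 / \<beta>)\<rfloor> = 0" "\<lfloor>\<beta> * (1 / \<beta>)\<rfloor> = 1"
    using assms by (simp_all add: floor_eq_iff field_simps)
  with comm assms have "\<lfloor>\<alpha>\<rfloor> = 0" by simp
  with assms show False by linarith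
qed

text \<open>Both sides equal \<open>\<lfloor>x\<rfloor> div (m * n)\<close>, which is symmetric in
  \<open>m\<close> and \<open>n\<close>. A zero index fits the same formula, as
  \<open>1 / 0 = 0\<close> and \<open>k div 0 = 0\<close>.\<close>

lemma dilated_floors_commute_reciprocals:
  "dilated_floors_commute (1 / real m) (1 / real n)"
proof -
  have nested: "\<lfloor>1 / real k * real_of_int \<lfloor>1 / real l * x\<rfloor>\<rfloor> = \<lfloor>x\<rfloor> div (int l * int k)"
    for k l :: nat and x :: real
  proof -
    have "\<lfloor>1 / real l * x\<rfloor> = \<lfloor>x\<rfloor> div int l"
      using floor_divide_real_eq_div[of "int l" x] by simp
    then show ?thesis
      using floor_divide_of_int_eq[of "\<lfloor>x\<rfloor> div int l" "int k"]
      by (simp add: zdiv_zmult2_eq)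
  qed
  show ?thesis
    unfolding dilated_floors_commute_def nested by (simp add: mult.commute)
qed

lemma dilated_floors_commute_iff:
  "dilated_floors_commute \<alpha> \<beta> \<longleftrightarrow>
     \<alpha> = \<beta> \<or> \<alpha> = 0 \<or> \<beta> = 0 \<or>
     (\<exists>m n :: nat. m \<ge> 1 \<and> n \<ge> 1 \<and> \<alpha> = 1 / real m \<and> \<beta> = 1 / real n)"
    (is "_ \<longleftrightarrow> ?R")
proof
  assume comm: "dilated_floors_commute \<alpha> \<beta>"
  note comm' = dilated_floors_commute_sym[OF comm]
  \<comment> \<open>The last four cases form two pairs exchanged by swapping \<alpha> and \<beta>,
    so \<open>comm'\<close> covers half of them.\<close>
  consider "\<alpha> = \<beta> \<or> \<alpha> = 0 \<or> \<beta> = 0" | "\<alpha> > 0" "\<beta> > 0" | "\<alpha> < 0" "\<beta> > 0" | "\<beta> < 0" "\<alpha> > 0"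
    | "\<beta> < \<alpha>" "\<alpha> < 0" | "\<alpha> < \<beta>" "\<beta> < 0"
    by linarith
  then show ?R
  proof cases
    case 2
    with dilated_floors_commute_pos[OF 2 comm] show ?thesis
      by (metis inverse_Ints_posE)
  qed (use comm comm' not_dilated_floors_commute_neg_pos
        not_dilated_floors_commute_neg_neg in blast)+
next
  assume ?R
  then show "dilated_floors_commute \<alpha> \<beta>"
    using dilated_floors_commute_reciprocals by (auto simp: dilated_floors_commute_def)
qed

theorem theorem1:
  shows "{(\<alpha> :: real, \<beta> :: real).
            \<forall>x :: real. \<lfloor>\<alpha> * real_of_int \<lfloor>\<beta> * x\<rfloor>\<rfloor> = \<lfloor>\<beta> * real_of_int \<lfloor>\<alpha> * x\<rfloor>\<rfloor>}
       = {(\<alpha>, \<alpha>) | \<alpha> :: real. True} \<union> {(\<alpha>, 0) | \<alpha> :: real. True} \<union> {(0, \<alpha>) | \<alpha> :: real. True}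
         \<union> {(1 / real m, 1 / real n) | m n :: nat. m \<ge> 1 \<and> n \<ge> 1}"
  unfolding dilated_floors_commute_def[symmetric] dilated_floors_commute_iff by blast

end
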